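(* If a finite commutative ring $R$ with identity is co-local, then $R$ is local.
   Context: A commutative ring $R$ is co-local if it contains a non-trivial ideal that is contained in every non-trivial proper ideal of $R$. A ring is local if it has a unique maximal ideal. *)

theory Defs
  imports "HOL-Algebra.Ideal"
begin

(* A non-trivial ideal is one different from the zero ideal.  The witness I is not required to
   be proper, so fields count as co-local; the zero ring does not. *)
definition co_local :: "('a, 'b) ring_scheme \<Rightarrow> bool" where
  "co_local R \<longleftrightarrow>
    (\<exists>I. ideal I R \<and> I \<noteq> {\<zero>\<^bsub>R\<^esub>} \<and>
      (\<forall>J. ideal J R \<and> J \<noteq> {\<zero>\<^bsub>R\<^esub>} \<and> J \<noteq> carrier R \<longrightarrow> I \<subseteq> J))"

definition local_ring :: "('a, 'b) ring_scheme \<Rightarrow> bool" where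
  "local_ring R \<longleftrightarrow> (\<exists>!M. maximalideal M R)"

end

theory Submission
  imports Defs
begin

text \<open>
  Let \<open>I\<close> be an ideal as in the definition of co-locality and \<open>x \<noteq> 0\<close> in \<open>I\<close>. The annihilator of
  \<open>x\<close> is proper, and it contains every proper ideal \<open>J\<close>: if \<open>a \<in> J\<close> and \<open>a x \<noteq> 0\<close>, then
  \<open>x \<in> (a x)\<close>, so \<open>x = b x\<close> for some \<open>b \<in> J\<close>. Put \<open>c = 1 - b\<close>. Then \<open>c x = 0\<close>, and since
  \<open>c\<^sup>k \<equiv> 1\<close> modulo \<open>J\<close>, no power of \<open>c\<close> vanishes; hence \<open>x \<in> (c\<^sup>k)\<close> for all \<open>k \<ge> 1\<close>. By finiteness
  \<open>c\<^sup>m = c\<^sup>n\<close> for some \<open>m < n\<close>, and writing \<open>x = c\<^sup>m y\<close> gives \<open>x = c\<^sup>n y = c\<^sup>n\<^sup>-\<^sup>m x = 0\<close>, a contradiction.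
\<close>

lemma (in cring) ideal_annihilator:
  assumes "x \<in> carrier R"
  shows "ideal {r \<in> carrier R. r \<otimes> x = \<zero>} R"
proof (rule idealI)
  show "subgroup {r \<in> carrier R. r \<otimes> x = \<zero>} (add_monoid R)"
    using assms by unfold_locales (auto simp: l_distr l_minus simp flip: a_inv_def)
next
  fix a r
  assume a: "a \<in> {r \<in> carrier R. r \<otimes> x = \<zero>}" and r: "r \<in> carrier R"
  then show "r \<otimes> a \<in> {r \<in> carrier R. r \<otimes> x = \<zero>}"
    using assms by (simp add: m_assoc)
  then show "a \<otimes> r \<in> {r \<in> carrier R. r \<otimes> x = \<zero>}"
    using a r by (simp add: m_comm)
qed (rule ring_axioms)

text \<open>Modulo \<open>J\<close> the element \<open>b\<close> vanishes, so every power of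
  \<open>\<one> \<ominus> b\<close> is congruent to \<open>\<one>\<close>.\<close>

lemma (in cring) one_minus_pow_in_ideal:
  assumes "ideal J R" "b \<in> J"
  shows "\<one> \<ominus> (\<one> \<ominus> b) [^] (k::nat) \<in> J"
proof -
  interpret J: ideal J R by fact
  have b: "b \<in> carrier R"
    using assms(2) by (rule J.Icarr)
  show ?thesis
  proof (induction k)
    case 0
    then show ?case
      by (simp add: r_neg minus_eq J.zero_closed)
  next
    case (Suc k)
    define p where "p = (\<one> \<ominus> b) [^] k"
    have p: "p \<in> carrier R"
      using b by (simp add: p_def)
    \<comment> \<open>This splits off the induction hypothesis; the remainder is a multiple of
      \<open>b\<close>.\<close>
    have "\<one> \<ominus> p \<otimes> (\<one> \<ominus> b) = (\<one> \<ominus> p) \<oplus> p \<otimes> b"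
      using b p by algebra
    moreover have "\<one> \<ominus> p \<in> J"
      using Suc by (simp add: p_def)
    moreover have "p \<otimes> b \<in> J"
      using assms(2) p by (rule J.I_l_closed)
    ultimately show ?case
      using J.a_closed by (simp add: p_def)
  qed
qed

text \<open>Co-locality enters only through \<open>min\<close>, for one fixed nonzero
  \<open>x\<close>; it is applied to principal ideals.\<close>

lemma (in cring) annihilator_max_proper_ideal:
  assumes fin: "finite (carrier R)"
    and x: "x \<in> carrier R" "x \<noteq> \<zero>"
    and min: "\<And>K. \<lbrakk>ideal K R; K \<noteq> {\<zero>}; K \<noteq> carrier R\<rbrakk> \<Longrightarrow> x \<in> K"
    and J: "ideal J R" "J \<noteq> carrier R"
  shows "J \<subseteq> {r \<in> carrier R. r \<otimes> x = \<zero>}"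
proof (rule ccontr)
  interpret J: ideal J R by fact
  assume "\<not> J \<subseteq> {r \<in> carrier R. r \<otimes> x = \<zero>}"
  then obtain a where a: "a \<in> J" "a \<in> carrier R" "a \<otimes> x \<noteq> \<zero>"
    using J.Icarr by blast
  have ax: "a \<otimes> x \<in> carrier R" "a \<otimes> x \<in> J"
    using a x J.I_r_closed by auto
  have "x \<in> PIdl (a \<otimes> x)"
  proof (rule min)
    show "ideal (PIdl (a \<otimes> x)) R"
      using ax by (simp add: cgenideal_ideal)
    show "PIdl (a \<otimes> x) \<noteq> {\<zero>}"
      using cgenideal_self[OF ax(1)] a by auto
    \<comment> \<open>The generator lies in the proper ideal \<open>J\<close>.\<close>
    show "PIdl (a \<otimes> x) \<noteq> carrier R"
      using cgenideal_minimal[OF J(1) ax(2)] J.a_subset J(2) by blast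
  qed
  then obtain r where r: "r \<in> carrier R" "x = r \<otimes> (a \<otimes> x)"
    by (auto simp: cgenideal_def)
  define b where "b = r \<otimes> a"
  have b: "b \<in> J" "b \<in> carrier R"
    using r a J.I_l_closed by (auto simp: b_def)
  have bx: "b \<otimes> x = x"
    using r a x by (simp add: b_def m_assoc)
  define c where "c = \<one> \<ominus> b"
  have c: "c \<in> carrier R"
    using b by (simp add: c_def)
  have "c \<otimes> x = x \<ominus> b \<otimes> x"
    using b x unfolding c_def by algebra
  then have cx: "c \<otimes> x = \<zero>"
    using x by (simp add: bx r_neg minus_eq)
  \<comment> \<open>Exponent 0 is excluded, as \<open>\<one>\<close> does not kill
    \<open>x\<close>.\<close>
  have pow_x: "c [^] k \<otimes> x = \<zero>" if "k > 0" for k :: nat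
    using that c x cx by (cases k) (auto simp: m_assoc)
  have pow_nonzero: "c [^] k \<noteq> \<zero>" for k :: nat
  proof
    assume "c [^] k = \<zero>"
    then have "\<one> \<in> J"
      using one_minus_pow_in_ideal[OF J(1) b(1), of k] by (simp add: c_def minus_eq)
    then show False
      using J.one_imp_carrier J(2) by blast
  qed
  have x_in_pow: "x \<in> PIdl (c [^] k)" if "k > 0" for k :: nat
  proof (rule min)
    show "ideal (PIdl (c [^] k)) R"
      using c by (simp add: cgenideal_ideal)
    show "PIdl (c [^] k) \<noteq> {\<zero>}"
      using cgenideal_self[of "c [^] k"] c pow_nonzero by auto
    \<comment> \<open>A unit cannot annihilate the nonzero \<open>x\<close>.\<close>
    show "PIdl (c [^] k) \<noteq> carrier R"
    proof
      assume "PIdl (c [^] k) = carrier R"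
      then have "\<one> \<in> PIdl (c [^] k)"
        by simp
      then obtain s where "s \<in> carrier R" "\<one> = s \<otimes> c [^] k"
        by (auto simp: cgenideal_def)
      then have "x = s \<otimes> (c [^] k \<otimes> x)"
        using c x by (metis l_one m_assoc nat_pow_closed)
      then show False
        using pow_x[OF that] \<open>s \<in> carrier R\<close> x by simp
    qed
  qed
  \<comment> \<open>Pigeonhole, over positive exponents so that \<open>x_in_pow\<close> applies to
    the smaller one.\<close>
  have "\<not> inj_on (\<lambda>k::nat. c [^] k) {0<..}"
    using c finite_subset[OF _ fin] infinite_Ioi[of "0::nat"]
    by (metis finite_imageD image_subsetI nat_pow_closed)
  then obtain m n :: nat where mn: "0 < m" "m < n" "c [^] m = c [^] n"
    unfolding inj_on_def by (metis greaterThan_iff linorder_neqE_nat)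
  obtain y where y: "y \<in> carrier R" "x = y \<otimes> c [^] m"
    using x_in_pow[OF mn(1)] by (auto simp: cgenideal_def)
  have "c [^] n = c [^] m \<otimes> c [^] (n - m)"
    using mn(2) c by (simp add: nat_pow_mult)
  then have "x = c [^] (n - m) \<otimes> x"
    using y mn(3) c by (metis m_assoc m_comm m_closed nat_pow_closed)
  then show False
    using pow_x[of "n - m"] mn x by simp
qed

theorem theorem2p6:
  fixes R :: "('a, 'b) ring_scheme"
  assumes "cring R"
    and "finite (carrier R)"
    and "co_local R"
  shows "local_ring R"
proof -
  interpret cring R by fact
  obtain I where I: "ideal I R" "I \<noteq> {\<zero>\<^bsub>R\<^esub>}"
    and I_min: "\<And>K. \<lbrakk>ideal K R; K \<noteq> {\<zero>\<^bsub>R\<^esub>}; K \<noteq> carrier R\<rbrakk> \<Longrightarrow> I \<subseteq> K"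
    using assms(3) unfolding co_local_def by blast
  interpret I: ideal I R by fact
  obtain x where x: "x \<in> I" "x \<noteq> \<zero>\<^bsub>R\<^esub>"
    using I(2) I.zero_closed by auto
  then have xR: "x \<in> carrier R"
    using I.Icarr by simp
  define A where "A = {r \<in> carrier R. r \<otimes>\<^bsub>R\<^esub> x = \<zero>\<^bsub>R\<^esub>}"
  have A: "ideal A R"
    unfolding A_def using xR by (rule ideal_annihilator)
  have A_proper: "A \<noteq> carrier R"
    using x xR one_closed by (force simp: A_def)
  have A_max: "J \<subseteq> A" if "ideal J R" "J \<noteq> carrier R" for J
    unfolding A_def
    using annihilator_max_proper_ideal[OF assms(2) xR x(2)] I_min x(1) that by blast
  have "maximalideal A R"
    using A A_proper A_max by (intro maximalidealI) auto
  \<comment> \<open>Since \<open>M\<close> lies in the proper ideal \<open>A\<close>, its maximality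
    forces equality.\<close>
  moreover have "M = A" if "maximalideal M R" for M
  proof -
    interpret M: maximalideal M R by fact
    have "M \<subseteq> A"
      using A_max M.ideal_axioms M.I_notcarr by blast
    then show ?thesis
      using M.I_maximal[OF A] A_proper ideal.Icarr[OF A] by blast
  qed
  ultimately show ?thesis
    unfolding local_ring_def by blast
qed

end
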